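(* Let $\tilde G:\mathbb{R}\to(0,1]$ be a continuously differentiable cumulative distribution function, let $b\in\mathbb{R}$, let $\gamma(b)>0$ and $\gamma'(b)<0$ be given real numbers, and suppose $1-\tilde G(b)>0$. For $\kappa\ge 0$, let $c=c(\kappa)$ denote the solution (where it exists) of $$b - c - \frac{(1-\tilde{G}(b))\,\kappa + \int_{c-\kappa}^{b}(\tilde{\pi}-c+\kappa)\,d\tilde{G}(\tilde{\pi})}{\tilde{G}(b)} + \frac{\gamma(b)}{\gamma'(b)} = 0 .$$ Then: (i) At every $\kappa\ge 0$ at which the solution $c(\kappa)$ exists, the implicit function $c$ satisfies $$\frac{dc}{d\kappa} = -\frac{1 - \tilde{G}(b) + \int_{c - \kappa}^{b} \tilde{G}'(\tilde{\pi}) \, d\tilde{\pi}}{\tilde{G}(c - \kappa)} < 0,$$ so that the inverted cost $c(\kappa)$ is strictly decreasing in $\kappa$. (ii) The requirement $c(\kappa)\ge 0$ provides an upper bound on $\kappa$: the set of $\kappa\ge 0$ for which the solution $c(\kappa)$ exists and satisfies $c(\kappa)\ge 0$ is bounded above.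
   Context: Interpretation (not needed for the mathematics): a bidder with cost $c$ bids $b$, wins with probability $\gamma(b)$ (with derivative $\gamma'(b)<0$), and after being matched receives an outside offer with distribution function $G$; cancelling costs a penalty $\kappa\ge0$. The cancellation probability given bid $b$ is $1-G(b+\kappa)$, so the location-normalized distribution $\tilde G(x)=G(x+\kappa)$ is known from data and is held fixed as $\kappa$ varies. The displayed equation is the first-order condition for the optimal bid, solved for the cost $c$ with $b$ (e.g. the lowest bid in the data) and $\tilde G$ given. Integrals use the usual orientation convention $\int_a^b=-\int_b^a$ if $a>b$. In (i), at $\kappa=0$ the derivative may be read as one-sided (from the right). *)

theory Defs
  imports "HOL-Probability.Probability"
begin

definition is_cdf :: "(real \<Rightarrow> real) \<Rightarrow> bool" where
  "is_cdf G \<longleftrightarrow> (\<exists>M. real_distribution M \<and> cdf M = G)"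

(* Stieltjes integral with respect to dG over the oriented interval from l to u; the library's
   interval integral supplies the sign when u < l.  It uses the open interval, so endpoint atoms
   would matter; here G is continuous and there are none. *)
definition stieltjes_integral ::
    "(real \<Rightarrow> real) \<Rightarrow> real \<Rightarrow> real \<Rightarrow> (real \<Rightarrow> real) \<Rightarrow> real" where
  "stieltjes_integral G l u f = (LINT x=l..u|interval_measure G. f x)"

(* In foc G b \<gamma> \<gamma>' \<kappa> c, the real numbers \<gamma> and \<gamma>' are the values at the bid b of the winning
   probability and of its derivative. *)
definition foc ::
    "(real \<Rightarrow> real) \<Rightarrow> real \<Rightarrow> real \<Rightarrow> real \<Rightarrow> real \<Rightarrow> real \<Rightarrow> bool" where
  "foc G b \<gamma> \<gamma>' \<kappa> c \<longleftrightarrow>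
     b - c
       - ((1 - G b) * \<kappa> + stieltjes_integral G (c - \<kappa>) b (\<lambda>\<pi>. \<pi> - c + \<kappa>)) / G b
       + \<gamma> / \<gamma>' = 0"

definition solvable_penalties ::
    "(real \<Rightarrow> real) \<Rightarrow> real \<Rightarrow> real \<Rightarrow> real \<Rightarrow> real set" where
  "solvable_penalties G b \<gamma> \<gamma>' = {\<kappa>. 0 \<le> \<kappa> \<and> (\<exists>c. foc G b \<gamma> \<gamma>' \<kappa> c)}"

end

(* Let P be an antiderivative of G and put a = c - \<kappa>.  Integration by parts turns the first-order
   condition into P b - P a = \<kappa> - G b * (\<gamma> / \<gamma>'), whose left-hand side is strictly decreasing in a
   with derivative - G a.  Hence c is unique, dc/d\<kappa> = 1 - 1 / G a, and a < b gives G a \<le> G b < 1.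
   Bounding P b - P a by (b - a) * G b shows that c \<ge> 0, i.e. a \<ge> - \<kappa>, forces
   \<kappa> * (1 - G b) \<le> b * G b + G b * (\<gamma> / \<gamma>'). *)
theory Submission
  imports Defs
begin

lemma is_cdf_mono: "is_cdf G \<Longrightarrow> mono G"
  unfolding is_cdf_def
  by (metis monoI finite_borel_measure.cdf_nondecreasing real_distribution.finite_borel_measure_M)

text \<open>A real distribution is determined by its cdf, so \<open>interval_measure G\<close> is
  the law witnessing \<open>is_cdf G\<close>. It agrees with the density measure on every ray
  \<open>{x<..}\<close>, since the fundamental theorem on a half-line and the limit 1 of
  \<open>G\<close> at infinity give both the mass \<open>1 - G x\<close>. This lets dG be replaced
  by \<open>g\<close> times Lebesgue measure.\<close>

lemma interval_measure_eq_density: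
  fixes G g :: "real \<Rightarrow> real"
  assumes G: "is_cdf G"
    and deriv: "\<And>x. (G has_real_derivative g x) (at x)"
    and g: "g \<in> borel_measurable borel" and nonneg: "\<And>x. 0 \<le> g x"
  shows "interval_measure G = density lborel g"
proof -
  obtain M where M: "real_distribution M" and cdf: "cdf M = G"
    using G by (auto simp: is_cdf_def)
  interpret real_distribution M by (rule M)
  have "interval_measure G = M"
  proof (rule cdf_unique)
    have *: "\<And>x y. x \<le> y \<Longrightarrow> G x \<le> G y" "\<And>a. continuous (at_right a) G"
      "(G \<longlongrightarrow> 0) at_bot" "(G \<longlongrightarrow> 1) at_top"
      using cdf_nondecreasing cdf_is_right_cont cdf_lim_at_bot cdf_lim_at_top_prob
      by (simp_all add: cdf)
    show "real_distribution (interval_measure G)"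
      by (rule real_distribution_interval_measure) (fact *)+
    show "cdf (interval_measure G) = cdf M"
      unfolding cdf by (rule cdf_interval_measure) (fact *)+
  qed (rule M)
  also have "M = density lborel g"
  proof (rule measure_eqI_lessThan)
    fix x :: real
    show "emeasure M {x<..} < \<infinity>"
      by (simp add: emeasure_eq_measure)
    have "measure M {x<..} = 1 - G x"
    proof -
      have "{x<..} = space M - {..x}" by auto
      then show ?thesis
        using prob_compl[of "{..x}"] by (simp add: cdf[symmetric] cdf_def)
    qed
    moreover have "emeasure (density lborel g) {x<..} = ennreal (1 - G x)"
    proof -
      have "emeasure (density lborel g) {x<..} = (\<integral>\<^sup>+y. ennreal (g y) * indicator {x<..} y \<partial>lborel)"
        using g by (subst emeasure_density) auto
      \<comment> \<open>The half-line fundamental theorem is stated for closed rays; the added point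
        is a null set.\<close>
      also have "\<dots> = (\<integral>\<^sup>+y. ennreal (g y) * indicator {x..} y \<partial>lborel)"
        using AE_lborel_singleton[of x]
        by (intro nn_integral_cong_AE) (auto elim!: eventually_mono split: split_indicator)
      also have "\<dots> = ennreal (1 - G x)"
        using g deriv nonneg cdf_lim_at_top_prob unfolding cdf by (rule nn_integral_FTC_atLeast)
      finally show ?thesis .
    qed
    ultimately show "emeasure M {x<..} = emeasure (density lborel g) {x<..}"
      by (simp add: emeasure_eq_measure)
  qed auto
  finally show ?thesis .
qed

lemma interval_lebesgue_integral_density:
  fixes f :: "real \<Rightarrow> real"
  assumes [measurable]: "f \<in> borel_measurable borel" "g \<in> borel_measurable borel"
    and "\<And>x. 0 \<le> g x"
  shows "(LINT x=a..b|density lborel g. f x) = (LBINT x=a..b. g x * f x)"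
  using assms(3)
  by (simp add: interval_lebesgue_integral_def set_lebesgue_integral_def integral_density
      mult.left_commute)

lemma interval_integral_FTC_real:
  fixes F f :: "real \<Rightarrow> real" and a b :: real
  assumes "continuous_on UNIV f" and "\<And>x. (F has_real_derivative f x) (at x)"
  shows "(LBINT x=a..b. f x) = F b - F a"
proof (rule interval_integral_FTC_finite)
  show "continuous_on {min a b..max a b} f"
    using assms(1) by (rule continuous_on_subset) simp
  show "(F has_vector_derivative f x) (at x within {min a b..max a b})" for x
    using assms(2) has_real_derivative_iff_has_vector_derivative
      has_vector_derivative_at_within by blast
qed

text \<open>\<open>(x - a) * G x - P x\<close> is an antiderivative of \<open>g x * (x - a)\<close>,
  and its product term vanishes at \<open>a\<close>. Integrals are oriented, so \<open>a\<close> and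
  \<open>b\<close> may come in either order.\<close>

lemma stieltjes_integral_by_parts:
  fixes G g P :: "real \<Rightarrow> real"
  assumes G: "is_cdf G"
    and deriv: "\<And>x. (G has_real_derivative g x) (at x)" and cont: "continuous_on UNIV g"
    and P: "\<And>x. (P has_real_derivative G x) (at x)"
  shows "stieltjes_integral G a b (\<lambda>x. x - a) = (b - a) * G b - (P b - P a)"
proof -
  have nonneg: "0 \<le> g x" for x
    using mono_on_imp_deriv_nonneg[OF is_cdf_mono[OF G] deriv] by simp
  have meas [measurable]: "g \<in> borel_measurable borel"
    using cont by (rule borel_measurable_continuous_onI)
  have "stieltjes_integral G a b (\<lambda>x. x - a) = (LBINT x=a..b. g x * (x - a))"
    unfolding stieltjes_integral_def interval_measure_eq_density[OF G deriv meas nonneg]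
    by (rule interval_lebesgue_integral_density) (auto simp: nonneg)
  also have "\<dots> = ((b - a) * G b - P b) - ((a - a) * G a - P a)"
  proof (rule interval_integral_FTC_real)
    show "continuous_on UNIV (\<lambda>x. g x * (x - a))"
      by (intro continuous_intros cont)
    show "((\<lambda>x. (x - a) * G x - P x) has_real_derivative g x * (x - a)) (at x)" for x
      by (rule derivative_eq_intros deriv P refl | simp)+
  qed
  finally show ?thesis by simp
qed

text \<open>The integrand vanishes at the lower limit \<open>c - \<kappa>\<close>, so integration by
  parts applies. After multiplication by \<open>G b\<close> the terms in \<open>b - c\<close> and
  \<open>\<kappa> * G b\<close> cancel, and \<open>c\<close> survives only through
  \<open>c - \<kappa>\<close>.\<close>

lemma foc_iff_antiderivative:
  fixes G g P :: "real \<Rightarrow> real"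
  assumes "is_cdf G" and "\<And>x. (G has_real_derivative g x) (at x)" and "continuous_on UNIV g"
    and "\<And>x. (P has_real_derivative G x) (at x)" and "G b \<noteq> 0"
  shows "foc G b \<gamma> \<gamma>' \<kappa> c \<longleftrightarrow> P (c - \<kappa>) = P b + G b * (\<gamma> / \<gamma>') - \<kappa>"
proof -
  have "(\<lambda>x. x - c + \<kappa>) = (\<lambda>x. x - (c - \<kappa>))" by auto
  then have "stieltjes_integral G (c - \<kappa>) b (\<lambda>x. x - c + \<kappa>)
      = (b - (c - \<kappa>)) * G b - (P b - P (c - \<kappa>))"
    using stieltjes_integral_by_parts[OF assms(1-4), of "c - \<kappa>" b] by simp
  moreover have "b - c - X / G b + r = 0 \<longleftrightarrow> X = (b - c + r) * G b" for X r
    using assms(5) eq_divide_eq[of "b - c + r" X "G b"] by (auto simp: algebra_simps)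
  ultimately show ?thesis
    unfolding foc_def by (simp only: ring_distribs) argo
qed

text \<open>The increment of \<open>P\<close> is \<open>y - x\<close> times a value of
  \<open>G\<close> between \<open>x\<close> and \<open>y\<close>. The upper estimate drives both the
  strict decrease of \<open>c\<close> and the bound on \<open>\<kappa>\<close>.\<close>

lemma mean_value_bounds_antiderivative_mono:
  fixes G P :: "real \<Rightarrow> real"
  assumes "mono G" and "\<And>x. (P has_real_derivative G x) (at x)" and "x \<le> y"
  shows "(y - x) * G x \<le> P y - P x" and "P y - P x \<le> (y - x) * G y"
proof -
  have "(y - x) * G x \<le> P y - P x \<and> P y - P x \<le> (y - x) * G y"
  proof (cases "x < y")
    case True
    then obtain z where "x < z" "z < y" and "P y - P x = (y - x) * G z"
      using MVT2[of x y P G] assms(2) by blast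
    then show ?thesis
      using monoD[OF assms(1), of x z] monoD[OF assms(1), of z y] by simp
  qed (use assms(3) in simp)
  then show "(y - x) * G x \<le> P y - P x" and "P y - P x \<le> (y - x) * G y"
    by auto
qed

text \<open>Inverse function theorem: global injectivity makes \<open>the_inv P\<close> a left
  inverse everywhere, and differentiability supplies the continuity of \<open>P\<close>.\<close>

lemma has_real_derivative_the_inv:
  fixes P P' :: "real \<Rightarrow> real"
  assumes "inj P" and P: "\<And>x. (P has_real_derivative P' x) (at x)" and "P' x \<noteq> 0"
  shows "(the_inv P has_real_derivative inverse (P' x)) (at (P x))"
  unfolding has_field_derivative_def
proof (rule has_derivative_inverse_strong[of UNIV x P])
  show "continuous_on UNIV P"
    using P by (meson DERIV_isCont continuous_at_imp_continuous_on)
  show "(P has_derivative (*) (P' x)) (at x)"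
    using P by (simp add: has_field_derivative_def)
  show "(*) (P' x) \<circ> (*) (inverse (P' x)) = id"
    using \<open>P' x \<noteq> 0\<close> by auto
qed (use \<open>inj P\<close> in \<open>auto simp: the_inv_f_f\<close>)

theorem mainTheorem2:
  fixes G :: "real \<Rightarrow> real" and b \<gamma> \<gamma>' :: real and c :: "real \<Rightarrow> real"
  assumes "is_cdf G"
    and "\<And>x. 0 < G x \<and> G x \<le> 1"
    and "G differentiable_on UNIV"
    and "continuous_on UNIV (deriv G)"
    and "0 < \<gamma>" and "\<gamma>' < 0"
    and "0 < 1 - G b"
    and "\<And>\<kappa>. \<kappa> \<in> solvable_penalties G b \<gamma> \<gamma>' \<Longrightarrow> foc G b \<gamma> \<gamma>' \<kappa> (c \<kappa>)"
  shows "(\<forall>\<kappa> \<in> solvable_penalties G b \<gamma> \<gamma>'. \<exists>!x. foc G b \<gamma> \<gamma>' \<kappa> x) \<and>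
    (\<forall>\<kappa> \<in> solvable_penalties G b \<gamma> \<gamma>'.
       (c has_real_derivative
          - ((1 - G b + (LBINT \<pi>=c \<kappa> - \<kappa>..b. deriv G \<pi>)) / G (c \<kappa> - \<kappa>)))
         (at \<kappa> within {0..}) \<and>
       - ((1 - G b + (LBINT \<pi>=c \<kappa> - \<kappa>..b. deriv G \<pi>)) / G (c \<kappa> - \<kappa>)) < 0) \<and>
    strict_antimono_on (solvable_penalties G b \<gamma> \<gamma>') c \<and>
    bdd_above {\<kappa> \<in> solvable_penalties G b \<gamma> \<gamma>'. 0 \<le> c \<kappa>}"
proof -
  define g where "g = deriv G"
  define S where "S = solvable_penalties G b \<gamma> \<gamma>'"
  define a where "a = (\<lambda>\<kappa>. c \<kappa> - \<kappa>)"
  have G_pos: "0 < G x" for x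
    using assms(2) by blast
  have mono: "mono G"
    using assms(1) by (rule is_cdf_mono)
  have G': "(G has_real_derivative g x) (at x)" for x
    using assms(3) unfolding g_def
    by (simp add: DERIV_deriv_iff_real_differentiable differentiable_on_def)
  have "\<exists>P. \<forall>x::real. -\<infinity> < ereal x \<longrightarrow> ereal x < \<infinity> \<longrightarrow> (P has_vector_derivative G x) (at x)"
    using G' by (intro einterval_antiderivative) (auto intro: DERIV_isCont)
  then obtain P where P: "(P has_real_derivative G x) (at x)" for x
    by (auto simp: has_real_derivative_iff_has_vector_derivative)
  note P_bounds = mean_value_bounds_antiderivative_mono[OF mono P]
  \<comment> \<open>With this constant the first-order condition reads
    \<open>P (c - \<kappa>) = L - \<kappa>\<close>. The sign of \<open>\<gamma>'\<close> puts
    \<open>L\<close> below \<open>P b\<close>, which later forces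
    \<open>a \<kappa> < b\<close>.\<close>
  define L where "L = P b + G b * (\<gamma> / \<gamma>')"
  have "L < P b"
    using G_pos[of b] assms(5,6) by (simp add: L_def mult_pos_neg divide_pos_neg)
  have foc_iff: "foc G b \<gamma> \<gamma>' \<kappa> x \<longleftrightarrow> P (x - \<kappa>) = L - \<kappa>" for \<kappa> x
    using foc_iff_antiderivative[OF assms(1) G' _ P, of b \<gamma> \<gamma>' \<kappa> x] assms(4) G_pos[of b]
    unfolding g_def L_def by auto
  have P_less: "P x < P y" if "x < y" for x y
    using that P G_pos by (blast intro: DERIV_pos_imp_increasing)
  then have "strict_mono P"
    by (rule strict_monoI)
  then have "inj P"
    by (rule strict_mono_imp_inj_on)
  have P_a: "P (a \<kappa>) = L - \<kappa>" and S_nonneg: "0 \<le> \<kappa>" if "\<kappa> \<in> S" for \<kappa>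
    using assms(8)[of \<kappa>] that by (auto simp: S_def foc_iff a_def solvable_penalties_def)
  \<comment> \<open>Solvability is reduced to a range condition on \<open>P\<close>, so that the
    intermediate value theorem can show that penalties near a solvable one are solvable.\<close>
  have S_I: "\<kappa> \<in> S" if "0 \<le> \<kappa>" and range: "L - \<kappa> \<in> range P" for \<kappa>
  proof -
    obtain x where "P x = L - \<kappa>"
      using range by auto
    then have "foc G b \<gamma> \<gamma>' \<kappa> (x + \<kappa>)"
      by (simp add: foc_iff)
    then show ?thesis
      using \<open>0 \<le> \<kappa>\<close> by (auto simp: S_def solvable_penalties_def)
  qed
  have a_less_b: "a \<kappa> < b" if "\<kappa> \<in> S" for \<kappa>
    using P_a[OF that] S_nonneg[OF that] \<open>L < P b\<close> strict_mono_less[OF \<open>strict_mono P\<close>, of "a \<kappa>" b]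
    by linarith
  then have G_a: "G (a \<kappa>) \<le> G b" "G (a \<kappa>) < 1" if "\<kappa> \<in> S" for \<kappa>
    using monoD[OF mono, of "a \<kappa>" b] a_less_b[OF that] assms(7) by auto

  have unique: "\<exists>!x. foc G b \<gamma> \<gamma>' \<kappa> x" if "\<kappa> \<in> S" for \<kappa>
  proof (rule ex1I)
    show "foc G b \<gamma> \<gamma>' \<kappa> (c \<kappa>)"
      using P_a[OF that] by (simp add: foc_iff a_def)
    show "x = c \<kappa>" if "foc G b \<gamma> \<gamma>' \<kappa> x" for x
      using that \<open>foc G b \<gamma> \<gamma>' \<kappa> (c \<kappa>)\<close> injD[OF \<open>inj P\<close>, of "x - \<kappa>" "c \<kappa> - \<kappa>"]
      by (simp add: foc_iff)
  qed

  \<comment> \<open>The integral is \<open>G b - G (a \<kappa>)\<close>, so the numerator collapses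
    to \<open>1 - G (a \<kappa>)\<close>.\<close>
  have D_eq: "- ((1 - G b + (LBINT \<pi>=c \<kappa> - \<kappa>..b. deriv G \<pi>)) / G (c \<kappa> - \<kappa>))
      = 1 - inverse (G (a \<kappa>))" for \<kappa>
  proof -
    have "(LBINT \<pi>=c \<kappa> - \<kappa>..b. deriv G \<pi>) = G b - G (a \<kappa>)"
      using interval_integral_FTC_real[of g G "a \<kappa>" b] assms(4) G' by (simp add: g_def a_def)
    then show ?thesis
      using G_pos[of "a \<kappa>"] by (simp only: a_def) (simp add: field_simps)
  qed
  have D_neg: "1 - inverse (G (a \<kappa>)) < 0" if "\<kappa> \<in> S" for \<kappa>
    using G_a(2)[OF that] G_pos[of "a \<kappa>"] by (simp add: one_less_inverse)

  have D: "(c has_real_derivative 1 - inverse (G (a \<kappa>))) (at \<kappa> within {0..})"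
    if "\<kappa> \<in> S" for \<kappa>
  proof -
    have c_eq: "c \<kappa>' = \<kappa>' + the_inv P (L - \<kappa>')" if "\<kappa>' \<in> S" for \<kappa>'
      using the_inv_f_f[OF \<open>inj P\<close>, of "a \<kappa>'"] P_a[OF that] by (simp add: a_def)
    have "((\<lambda>\<kappa>. L - \<kappa>) has_real_derivative -1) (at \<kappa> within {0..})"
      by (auto intro!: derivative_eq_intros)
    moreover have "(the_inv P has_real_derivative inverse (G (a \<kappa>))) (at (L - \<kappa>))"
      using has_real_derivative_the_inv[OF \<open>inj P\<close> P, of "a \<kappa>"] G_pos[of "a \<kappa>"] P_a[OF that] by simp
    ultimately have "((\<lambda>\<kappa>. the_inv P (L - \<kappa>)) has_real_derivative inverse (G (a \<kappa>)) * -1)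
        (at \<kappa> within {0..})"
      by (rule DERIV_chain2[rotated])
    then have "((\<lambda>\<kappa>. \<kappa> + the_inv P (L - \<kappa>)) has_real_derivative 1 + inverse (G (a \<kappa>)) * -1)
        (at \<kappa> within {0..})"
      by (intro DERIV_add DERIV_ident)
    \<comment> \<open>Outside \<open>S\<close> the function \<open>c\<close> is arbitrary, so the
      derivative within \<open>{0..}\<close> requires all nearby nonnegative penalties to lie in
      \<open>S\<close>. For these, \<open>L - \<kappa>'\<close> stays between the values of
      \<open>P\<close> at \<open>a \<kappa> - 1\<close> and \<open>a \<kappa> + 1\<close>, hence is
      attained.\<close>
    moreover have "eventually (\<lambda>\<kappa>. c \<kappa> = \<kappa> + the_inv P (L - \<kappa>)) (at \<kappa> within {0..})"
    proof -
      have lim: "((\<lambda>\<kappa>. L - \<kappa>) \<longlongrightarrow> P (a \<kappa>)) (at \<kappa> within {0..})"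
        unfolding P_a[OF that] by (intro tendsto_intros)
      have "eventually (\<lambda>\<kappa>'. \<kappa>' \<in> {0..}) (at \<kappa> within {0..})"
        by (simp add: eventually_at_filter)
      moreover have "eventually (\<lambda>\<kappa>'. P (a \<kappa> - 1) < L - \<kappa>') (at \<kappa> within {0..})"
        by (rule order_tendstoD(1)[OF lim]) (simp add: P_less)
      moreover have "eventually (\<lambda>\<kappa>'. L - \<kappa>' < P (a \<kappa> + 1)) (at \<kappa> within {0..})"
        by (rule order_tendstoD(2)[OF lim]) (simp add: P_less)
      ultimately show ?thesis
      proof eventually_elim
        case (elim \<kappa>')
        have "\<exists>x\<ge>a \<kappa> - 1. x \<le> a \<kappa> + 1 \<and> P x = L - \<kappa>'"
          using elim P by (intro IVT') (auto intro!: DERIV_continuous_on DERIV_subset[OF P])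
        then have "\<kappa>' \<in> S"
          using elim(1) by (intro S_I) (auto simp: image_iff intro: sym)
        then show ?case
          by (rule c_eq)
      qed
    qed
    ultimately show ?thesis
      using has_field_derivative_cong_eventually[of c "\<lambda>\<kappa>. \<kappa> + the_inv P (L - \<kappa>)" \<kappa> "{0..}"]
        c_eq[OF that] by simp
  qed

  \<comment> \<open>Two penalties are compared directly by the mean value bound, without integrating
    the derivative along \<open>S\<close>: since \<open>G (a \<kappa>) < 1\<close>, \<open>a\<close>
    falls by more than \<open>\<kappa>\<close> rises.\<close>
  have antimono: "strict_antimono_on S c"
  proof (rule monotone_onI)
    fix \<kappa> \<kappa>' assume S: "\<kappa> \<in> S" "\<kappa>' \<in> S" and "\<kappa> < \<kappa>'"
    then have "P (a \<kappa>') < P (a \<kappa>)"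
      using P_a by simp
    then have less: "a \<kappa>' < a \<kappa>"
      using strict_mono_less[OF \<open>strict_mono P\<close>] by blast
    have "\<kappa>' - \<kappa> = P (a \<kappa>) - P (a \<kappa>')"
      using P_a S by simp
    also have "\<dots> \<le> (a \<kappa> - a \<kappa>') * G (a \<kappa>)"
      using less by (intro P_bounds(2)) simp
    also have "\<dots> < a \<kappa> - a \<kappa>'"
      using less G_a(2)[OF S(1)] by simp
    finally show "c \<kappa>' < c \<kappa>"
      by (simp add: a_def)
  qed

  \<comment> \<open>The constant comes from solving
    \<open>P b - L + \<kappa> \<le> (b + \<kappa>) * G b\<close> for \<open>\<kappa>\<close>, whose
    net coefficient \<open>1 - G b\<close> is positive.\<close>
  have "\<kappa> \<le> (b * G b - (P b - L)) / (1 - G b)" if "\<kappa> \<in> S" "0 \<le> c \<kappa>" for \<kappa>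
  proof -
    have "P b - L + \<kappa> = P b - P (a \<kappa>)"
      using P_a[OF that(1)] by simp
    also have "\<dots> \<le> (b - a \<kappa>) * G b"
      using a_less_b[OF that(1)] by (intro P_bounds(2)) simp
    also have "\<dots> \<le> (b + \<kappa>) * G b"
      using that(2) G_pos[of b] by (simp add: a_def)
    finally show ?thesis
      using assms(7) by (simp add: field_simps)
  qed
  then have "bdd_above {\<kappa> \<in> S. 0 \<le> c \<kappa>}"
    by (intro bdd_aboveI) auto
  then show ?thesis
    unfolding D_eq S_def[symmetric] using unique D D_neg antimono by blast
qed

end
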